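(* Let $q$ be a prime power and let $k \ge 3$ be an integer. For $B \in \mathbb{F}_{q^k}^{\times}$ let $F_B(X) = X^{q+1} - BX + B \in \mathbb{F}_{q^k}[X]$. Define polynomials $P_i(X) \in \mathbb{F}_q[X]$ by $P_1(X) = 1$, $P_2(X) = 1$, and for $i \ge 3$, \[ P_i(X) = P_{i-1}(X) - X^{q^{i-3}} P_{i-2}(X). \] Then for every $B \in \mathbb{F}_{q^k}^{\times}$, the polynomial $F_B(X)$ splits completely over $\mathbb{F}_{q^k}$ (i.e., factors into a product of $q+1$ linear polynomials in $\mathbb{F}_{q^k}[X]$) if and only if $P_k\!\left(\frac{1}{B}\right) = 0$.
   Context: An element $B \in \mathbb{F}_{q^k}^{\times}$ for which $X^{q+1} - BX + B$ splits completely over $\mathbb{F}_{q^k}$ is called a Bluher value; the theorem characterises Bluher values as the inverses of the roots of $P_k$ in $\mathbb{F}_{q^k}^{\times}$. *)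

theory Defs
  imports
    "HOL-Library.Cardinality"
    "HOL-Computational_Algebra.Polynomial"
    "HOL-Number_Theory.Prime_Powers"
begin

definition F_poly :: "nat \<Rightarrow> 'a::comm_ring_1 \<Rightarrow> 'a poly" where
  "F_poly q B = monom 1 (q + 1) - monom B 1 + [:B:]"

(* The sequence starts at index 1; the value at index 0 is junk.
   The coefficients always lie in the prime subring (see coeff_P_poly_Ints), so over a field
   with q^k elements this is the polynomial over the subfield with q elements, regarded as a
   polynomial over the larger field. *)
fun P_poly :: "nat \<Rightarrow> nat \<Rightarrow> 'a::comm_ring_1 poly" where
  "P_poly q 0 = 0"
| "P_poly q (Suc 0) = 1"
| "P_poly q (Suc (Suc 0)) = 1"
| "P_poly q (Suc (Suc (Suc i))) =
     P_poly q (Suc (Suc i)) - monom 1 (q ^ i) * P_poly q (Suc i)"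

lemma P_poly_1: "P_poly q 1 = 1"
  and P_poly_2: "P_poly q 2 = 1"
  by (simp_all add: numeral_2_eq_2)

lemma P_poly_rec:
  assumes "i \<ge> 3"
  shows "P_poly q i = P_poly q (i - 1) - monom 1 (q ^ (i - 3)) * P_poly q (i - 2)"
proof -
  from assms have "i = Suc (Suc (Suc (i - 3)))" by simp
  then obtain j where "i = Suc (Suc (Suc j))" ..
  then show ?thesis
    by (simp add: numeral_3_eq_3 numeral_2_eq_2)
qed

lemma coeff_P_poly_Ints: "coeff (P_poly q i) n \<in> \<int>"
  by (induction q i arbitrary: n rule: P_poly.induct) (auto simp: coeff_1 coeff_monom_mult)

end

(* On a root x of F_B the Frobenius acts as a Moebius map, x^q = (B x - B) / x. Composing its
   conjugates gives x^(q^k) = (a_k x + b') / (a_(k-1) x + b) with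
   a_i = B^(1 + q + ... + q^(i-1)) P_(i+1)(1/B). As F_B is separable, it splits over the field
   with q^k elements iff this map fixes all of its q + 1 roots.
   If it does, then a_(k-1) x^2 + (b - a_k) x - b' has more than two zeros, so a_(k-1) = 0.
   Conversely, if a_(k-1) = 0 then X^(q^k) is congruent modulo F_B to an affine polynomial
   alpha X + beta, which F_B maps to 0 modulo F_B; comparing coefficients forces alpha = 1 and
   beta = 0, so F_B divides X^(q^k) - X. *)

theory Submission
  imports Defs
begin

section \<open>Frobenius in finite fields\<close>

lemma finite_imp_prime_CHAR: "prime CHAR('a::{field, finite})"
  by (rule prime_CHAR_semidom[OF finite_imp_CHAR_pos[OF finite]])

text \<open>The translation by 1 permutes the field, so it fixes the sum of all elements, yet it
  adds \<open>CARD('a)\<close> ones to it.\<close>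

lemma of_nat_CARD_eq_0: "of_nat CARD('a::{field, finite}) = (0::'a)"
proof -
  have "(\<Sum>y\<in>UNIV. y :: 'a) = (\<Sum>y\<in>UNIV. y + 1)"
    by (rule sum.reindex_bij_witness[of _ "\<lambda>y. y + 1" "\<lambda>y. y - 1"]) auto
  then show ?thesis
    by (simp add: sum.distrib)
qed

lemma power_CARD_eq_same: "(x::'a::{field, finite}) ^ CARD('a) = x"
proof (cases "x = 0")
  case False
  have "(\<Prod>y\<in>UNIV - {0}. y) = (\<Prod>y\<in>UNIV - {0}. x * y)"
    by (rule prod.reindex_bij_witness[of _ "\<lambda>y. x * y" "\<lambda>y. y / x"]) (use False in auto)
  also have "\<dots> = x ^ (CARD('a) - 1) * (\<Prod>y\<in>UNIV - {0}. y)"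
    by (simp add: prod.distrib)
  finally have "x ^ (CARD('a) - 1) = 1"
    by simp
  then have "x * x ^ (CARD('a) - 1) = x"
    by simp
  then show ?thesis
    by (simp flip: power_Suc)
qed (simp add: power_0_left)

text \<open>Makes \<open>q\<close>-th powers additive. The characteristic divides
  \<open>q ^ k\<close>, hence equals the prime below \<open>q\<close>.\<close>

lemma primepow_CARD_eq_CHAR_power:
  assumes "primepow q" and "CARD('a::{field, finite}) = q ^ k"
  obtains m where "m > 0" and "q = CHAR('a) ^ m"
proof -
  obtain p m where pm: "prime p" "m > 0" "q = p ^ m"
    using assms(1) by (auto simp: primepow_def)
  have "CHAR('a) dvd (p ^ m) ^ k"
    using of_nat_CARD_eq_0[where 'a = 'a] by (simp add: assms(2) pm(3) of_nat_eq_0_iff_char_dvd del: of_nat_power)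
  then have "CHAR('a) dvd p"
    using finite_imp_prime_CHAR[where 'a = 'a] prime_dvd_power by blast
  then have "CHAR('a) = p"
    using pm(1) finite_imp_prime_CHAR[where 'a = 'a] primes_dvd_imp_eq by blast
  with pm show thesis
    by (intro that) auto
qed

lemma power_CHAR_power_diff:
  fixes x y :: "'a::comm_ring_1"
  assumes "prime CHAR('a)" and "n = CHAR('a) ^ m"
  shows "(x - y) ^ n = x ^ n - y ^ n"
  using freshmans_dream'[OF assms, of "x - y" y] by (simp add: algebra_simps)

section \<open>Powers, coefficients and degree of \<open>F_poly\<close>\<close>

lemma F_poly_altdef:
  "F_poly q B = [:0, 1:] ^ q * [:0, 1:] - [:B:] * [:0, 1:] + [:B:]"
  by (simp add: F_poly_def monom_altdef mult.commute)

text \<open>Raising to the \<open>n\<close>-th power is a ring endomorphism. The result is kept as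
  an expression in \<open>X^n\<close>, to be read as a relation between \<open>X^n\<close> and its
  \<open>q\<close>-th power.\<close>

lemma F_poly_power:
  fixes B :: "'a::field"
  assumes "prime CHAR('a)" and "n = CHAR('a) ^ m"
  shows "F_poly q B ^ n =
    ([:0, 1:] ^ n) ^ q * [:0, 1:] ^ n - [:B ^ n:] * [:0, 1:] ^ n + [:B ^ n:]"
proof -
  have "prime CHAR('a poly)" "n = CHAR('a poly) ^ m"
    using assms by simp_all
  note frob = freshmans_dream'[OF this] power_CHAR_power_diff[OF this]
  show ?thesis
    unfolding F_poly_altdef frob power_mult_distrib
    by (simp add: poly_const_pow mult.commute flip: power_mult)
qed

lemma coeff_F_poly:
  assumes "q > 1"
  shows "coeff (F_poly q B) n =
    (if n = q + 1 then 1 else if n = 1 then - B else if n = 0 then B else 0)"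
  using assms by (auto simp: F_poly_def coeff_monom coeff_pCons split: nat.splits)

lemma degree_F_poly:
  assumes "q > 1"
  shows "degree (F_poly q B) = q + 1"
  by (rule antisym[OF degree_le le_degree]) (use assms in \<open>auto simp: coeff_F_poly\<close>)

lemma F_poly_dvd_imp_eq_0:
  fixes B :: "'a::field"
  assumes "q > 1" and "F_poly q B dvd p" and "degree p \<le> q"
  shows "p = 0"
  using dvd_imp_degree_le[OF assms(2)] assms degree_F_poly[OF assms(1), of B] by auto

section \<open>Iterated Frobenius as Moebius maps\<close>

text \<open>The \<open>a_i\<close> of the overview. The product clears the denominators of
  \<open>P_(i+1)(1/B)\<close>; note the index shift.\<close>

definition frob_coeff :: "nat \<Rightarrow> 'a::field \<Rightarrow> nat \<Rightarrow> 'a" where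
  "frob_coeff q B i = (\<Prod>j<i. B ^ (q ^ j)) * poly (P_poly q (Suc i)) (1 / B)"

lemma frob_coeff_0 [simp]: "frob_coeff q B 0 = 1"
  and frob_coeff_1 [simp]: "frob_coeff q B (Suc 0) = B"
  by (simp_all add: frob_coeff_def)

lemma frob_coeff_rec:
  assumes "B \<noteq> 0"
  shows "frob_coeff q B (Suc (Suc i)) =
    B ^ (q ^ Suc i) * (frob_coeff q B (Suc i) - frob_coeff q B i)"
  using assms by (simp add: frob_coeff_def poly_monom field_simps)

text \<open>By the recursion, two consecutive zeros would propagate down to
  \<open>a_0 = 1\<close>.\<close>

lemma frob_coeff_consecutive_nonzero:
  assumes "B \<noteq> 0" and "frob_coeff q B i = 0"
  shows "frob_coeff q B (Suc i) \<noteq> 0"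
  using assms(2)
proof (induction i)
  case (Suc i)
  with assms(1) show ?case
    by (auto simp: frob_coeff_rec)
qed simp

text \<open>The Moebius formula for \<open>X^(q^(i+1))\<close> with its denominator cleared. Only
  the coefficients of \<open>X\<close> need to be known, so the constant terms stay
  existential.\<close>

lemma frobenius_mobius_cong:
  fixes B :: "'a::field"
  assumes "prime CHAR('a)" and q: "q = CHAR('a) ^ m" and "B \<noteq> 0"
  shows "\<exists>b b'. F_poly q B dvd
    [:0, 1:] ^ (q ^ Suc i) * [:b, frob_coeff q B i:] - [:b', frob_coeff q B (Suc i):]"
proof (induction i)
  case 0
  have "F_poly q B = [:0, 1:] ^ (q ^ Suc 0) * [:0, frob_coeff q B 0:] - [:- B, frob_coeff q B (Suc 0):]"
    by (simp add: F_poly_altdef)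
  then show ?case
    by (metis dvd_refl)
next
  case (Suc i)
  define F where "F = F_poly q B"
  define n where "n = q ^ Suc i"
  define Y where "Y = [:0, 1::'a:] ^ n"
  define c where "c = B ^ n"
  from Suc obtain b b' where
    IH: "F dvd Y * [:b, frob_coeff q B i:] - [:b', frob_coeff q B (Suc i):]" 
    by (auto simp: F_def Y_def n_def)
  define u where "u = [:b, frob_coeff q B i:]"
  define v where "v = [:b', frob_coeff q B (Suc i):]"
  \<comment> \<open>With \<open>Y = v / u\<close>, the conjugated relation
    \<open>Y^q = c (Y - 1) / Y\<close> gives \<open>Y^q = c (v - u) / v\<close>, so \<open>v\<close>
    is the next denominator and \<open>w\<close> the next numerator.\<close>
  define w where "w = [:c * (b' - b), frob_coeff q B (Suc (Suc i)):]"
  have w: "w = [:c:] * (v - u)"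
    using assms(3) by (simp add: u_def v_def w_def c_def n_def frob_coeff_rec)
  have "n = CHAR('a) ^ (m * Suc i)"
    by (simp add: n_def q power_mult power_add)
  then have "F ^ n = Y ^ q * Y - [:c:] * Y + [:c:]"
    unfolding F_def Y_def c_def using assms(1) by (intro F_poly_power) auto
  moreover have "n > 0"
    using assms(1) by (simp add: n_def q prime_gt_0_nat)
  ultimately have "F dvd Y ^ q * Y - [:c:] * Y + [:c:]"
    using dvd_power[of n F] by simp
  \<comment> \<open>This combination cancels \<open>Y\<close> and leaves only \<open>Y ^ q\<close>,
    with no division modulo \<open>F\<close>.\<close>
  then have "F dvd u * (Y ^ q * Y - [:c:] * Y + [:c:]) - (Y ^ q - [:c:]) * (Y * u - v)"
    using IH by (intro dvd_diff[OF dvd_mult dvd_mult]) (simp_all only: u_def v_def)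
  also have "\<dots> = Y ^ q * v - w"
    by (simp add: w algebra_simps smult_diff_right)
  also have "Y ^ q = [:0, 1:] ^ (q ^ Suc (Suc i))"
    by (simp add: Y_def n_def mult_ac flip: power_mult)
  finally show ?case
    unfolding F_def v_def w_def by blast
qed

section \<open>Separability and splitting\<close>

text \<open>As \<open>q\<close> vanishes in the field, the derivative is \<open>X^q - B\<close>, and
  at its zeros \<open>F_poly q B\<close> takes the value \<open>B\<close>.\<close>

lemma F_poly_pderiv_nonzero:
  fixes B :: "'a::field"
  assumes "of_nat q = (0::'a)" and "B \<noteq> 0" and "poly (F_poly q B) x = 0"
  shows "poly (pderiv (F_poly q B)) x \<noteq> 0"
proof
  assume "poly (pderiv (F_poly q B)) x = 0"
  then have "x ^ q = B"
    using assms(1) by (simp add: F_poly_def pderiv_add pderiv_diff pderiv_monom poly_monom pderiv_pCons)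
  then show False
    using assms(2,3) by (simp add: F_poly_def poly_monom)
qed

lemma card_roots_prod_list_linear:
  fixes ls :: "'a::field poly list"
  assumes "\<forall>l\<in>set ls. degree l = 1"
    and "\<And>x. poly (prod_list ls) x = 0 \<Longrightarrow> poly (pderiv (prod_list ls)) x \<noteq> 0"
  shows "card {x. poly (prod_list ls) x = 0} = length ls"
  using assms
proof (induction ls)
  case (Cons l ls)
  obtain r where r: "\<And>x. poly l x = 0 \<longleftrightarrow> x = r"
  proof -
    from Cons.prems(1) have "degree l = 1"
      by simp
    then obtain c d where l: "l = [:c, d:]" "d \<noteq> 0"
      by (metis degree1_coeffs One_nat_def)
    show thesis
      by (rule that[of "- c / d"]) (use l in \<open>auto simp: field_simps add_eq_0_iff\<close>)
  qed
  let ?m = "prod_list ls"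
  have deriv: "poly (pderiv (l * ?m)) x = poly l x * poly (pderiv ?m) x + poly ?m x * poly (pderiv l) x" for x
    by (simp add: pderiv_mult)
  \<comment> \<open>Otherwise both terms of \<open>deriv\<close> would vanish at \<open>r\<close>,
    making it a multiple root.\<close>
  have "poly ?m r \<noteq> 0"
    using Cons.prems(2)[of r] r[of r] deriv[of r] by auto
  moreover have "card {x. poly ?m x = 0} = length ls"
    using Cons.prems deriv by (intro Cons.IH) fastforce+
  moreover have "{x. poly (prod_list (l # ls)) x = 0} = insert r {x. poly ?m x = 0}"
    using r by auto
  moreover have "finite {x. poly ?m x = 0}"
    using \<open>poly ?m r \<noteq> 0\<close> by (intro poly_roots_finite) auto
  ultimately show ?case
    by simp
qed simp

text \<open>Both sides are monic of the same degree and agree at that many points, so their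
  difference has too many roots for its degree.\<close>

lemma monic_card_roots_imp_prod:
  fixes p :: "'a::field poly"
  assumes "lead_coeff p = 1" and "degree p \<le> card {x. poly p x = 0}"
  shows "p = (\<Prod>r | poly p r = 0. [:- r, 1:])"
proof -
  let ?S = "{x. poly p x = 0}"
  have "p \<noteq> 0"
    using assms(1) by auto
  then have card: "card ?S = degree p" and fin: "finite ?S"
    using assms(2) card_poly_roots_bound[of p] poly_roots_finite[of p] by auto
  have deg: "degree (\<Prod>r\<in>?S. [:- r, 1:]) = card ?S"
    by (subst degree_prod_eq_sum_degree) auto
  moreover have "lead_coeff (\<Prod>r\<in>?S. [:- r, 1:]) = 1"
    by (simp add: lead_coeff_prod)
  ultimately have "coeff p (card ?S) = coeff (\<Prod>r\<in>?S. [:- r, 1:]) (card ?S)"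
    using assms(1) card by simp
  then show ?thesis
    by (rule poly_eqI_degree_lead_coeff[where A = ?S])
      (use deg card fin in \<open>auto simp: poly_prod\<close>)
qed

text \<open>Reduces splitting to a root count; separability makes the roots of the linear factors
  distinct.\<close>

lemma F_poly_splits_iff_card_roots:
  fixes B :: "'a::field"
  assumes "q > 1" and "of_nat q = (0::'a)" and "B \<noteq> 0"
  shows "(\<exists>ls. length ls = q + 1 \<and> (\<forall>l\<in>set ls. degree l = 1) \<and> F_poly q B = prod_list ls)
    \<longleftrightarrow> card {x. poly (F_poly q B) x = 0} \<ge> q + 1"
proof
  assume "\<exists>ls. length ls = q + 1 \<and> (\<forall>l\<in>set ls. degree l = 1) \<and> F_poly q B = prod_list ls"
  then obtain ls where "length ls = q + 1" "\<forall>l\<in>set ls. degree l = 1" "F_poly q B = prod_list ls"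
    by blast
  then show "card {x. poly (F_poly q B) x = 0} \<ge> q + 1"
    using card_roots_prod_list_linear[of ls] F_poly_pderiv_nonzero[OF assms(2,3)] by simp
next
  let ?S = "{x. poly (F_poly q B) x = 0}"
  assume card: "card ?S \<ge> q + 1"
  have "lead_coeff (F_poly q B) = 1"
    using assms(1) by (simp add: degree_F_poly coeff_F_poly)
  then have prod: "F_poly q B = (\<Prod>r\<in>?S. [:- r, 1:])"
    using card assms(1) by (intro monic_card_roots_imp_prod) (simp_all add: degree_F_poly)
  have "F_poly q B \<noteq> 0"
    using degree_F_poly[OF assms(1), of B] by auto
  then have "finite ?S" "card ?S \<le> q + 1"
    using poly_roots_finite card_poly_roots_bound[of "F_poly q B"] degree_F_poly[OF assms(1), of B]
    by auto
  then obtain rs where rs: "distinct rs" "set rs = ?S"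
    using finite_distinct_list by blast
  then have "length rs = q + 1"
    using card \<open>card ?S \<le> q + 1\<close> distinct_card[of rs] by simp
  moreover have "F_poly q B = prod_list (map (\<lambda>r. [:- r, 1:]) rs)"
    using prod prod.distinct_set_conv_list[OF rs(1)] unfolding rs(2) by metis
  ultimately show "\<exists>ls. length ls = q + 1 \<and> (\<forall>l\<in>set ls. degree l = 1) \<and> F_poly q B = prod_list ls"
    by (intro exI[of _ "map (\<lambda>r. [:- r, 1:]) rs"]) auto
qed

section \<open>Affine substitutions modulo \<open>F_poly\<close>\<close>

text \<open>The divisibility says that \<open>X \<mapsto> \<alpha> X + \<beta>\<close> induces an endomorphism of \<open>K[X]/(F\<^sub>B)\<close>.\<close>

lemma affine_endomorphism_F_poly:
  fixes B :: "'a::field"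
  assumes "prime CHAR('a)" and q: "q = CHAR('a) ^ m" "q > 1" and "B \<noteq> 0" and "\<alpha> \<noteq> 0"
    and dvd: "F_poly q B dvd [:\<beta>, \<alpha>:] ^ q * [:\<beta>, \<alpha>:] - [:B:] * [:\<beta>, \<alpha>:] + [:B:]"
  shows "\<alpha> = 1" and "\<beta> = 0"
proof -
  define L where "L = [:\<beta>, \<alpha>:]"
  define X where "X = [:0, 1::'a:]"
  have "prime CHAR('a poly)" "q = CHAR('a poly) ^ m"
    using assms by simp_all
  note frob = freshmans_dream'[OF this]
  have L: "L = [:\<beta>:] + [:\<alpha>:] * X"
    by (simp add: L_def X_def)
  have Lq: "L ^ q = [:\<beta> ^ q:] + [:\<alpha> ^ q:] * X ^ q"
    unfolding L frob power_mult_distrib by (simp add: poly_const_pow)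
  \<comment> \<open>The constant and linear coefficients left after subtracting
    \<open>\<alpha>^(q+1) F_B\<close>, which cancels the term in \<open>X^(q+1)\<close>. The
    remainder has degree at most \<open>q\<close>, so it must be zero.\<close>
  define c0 where "c0 = \<beta> ^ q * \<beta> - B * \<beta> + B - \<alpha> ^ q * \<alpha> * B"
  define c1 where "c1 = \<beta> ^ q * \<alpha> - B * \<alpha> + \<alpha> ^ q * \<alpha> * B"
  define r where "r = monom (\<alpha> ^ q * \<beta>) q + [:c0, c1:]"
  have "F_poly q B dvd (L ^ q * L - [:B:] * L + [:B:]) - [:\<alpha> ^ q * \<alpha>:] * F_poly q B"
    using dvd unfolding L_def by (intro dvd_diff dvd_mult) auto
  also have "\<dots> = [:\<alpha> ^ q * \<beta>:] * X ^ q + [:c0:] + [:c1:] * X"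
    unfolding Lq F_poly_altdef X_def[symmetric]
    by (simp add: L algebra_simps smult_add_right smult_diff_right smult_add_left smult_diff_left c0_def c1_def)
  also have "\<dots> = r"
    by (simp add: r_def X_def monom_altdef)
  finally have "F_poly q B dvd r" .
  moreover have "degree r \<le> q"
    unfolding r_def using q(2) by (intro degree_add_le degree_monom_le) simp
  ultimately have r0: "r = 0"
    by (rule F_poly_dvd_imp_eq_0[OF q(2)])
  have "coeff r q = \<alpha> ^ q * \<beta>" "coeff r 0 = c0" "coeff r 1 = c1"
    using q(2) by (auto simp: r_def coeff_pCons split: nat.splits)
  with r0 have z: "\<alpha> ^ q * \<beta> = 0" "c0 = 0" "c1 = 0"
    by simp_all
  from z(1) show "\<beta> = 0"
    using \<open>\<alpha> \<noteq> 0\<close> by simp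
  then have "\<alpha> ^ q * \<alpha> = 1"
    using z(2) \<open>B \<noteq> 0\<close> q(2) by (simp add: c0_def)
  then have "c1 = B * (1 - \<alpha>)"
    using \<open>\<beta> = 0\<close> q(2) by (simp add: c1_def power_0_left right_diff_distrib)
  then show "\<alpha> = 1"
    using z(3) \<open>B \<noteq> 0\<close> by simp
qed

lemma F_poly_dvd_frobenius:
  fixes B :: "'a::field"
  assumes "prime CHAR('a)" and q: "q = CHAR('a) ^ m" "q > 1" and "B \<noteq> 0"
    and "B ^ (q ^ Suc i) = B" and zero: "frob_coeff q B i = 0"
  shows "F_poly q B dvd [:0, 1:] ^ (q ^ Suc i) - [:0, 1:]"
proof -
  define F where "F = F_poly q B"
  define n where "n = q ^ Suc i"
  define Y where "Y = [:0, 1::'a:] ^ n"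
  define a where "a = frob_coeff q B (Suc i)"
  have "a \<noteq> 0"
    unfolding a_def using frob_coeff_consecutive_nonzero[OF \<open>B \<noteq> 0\<close> zero] .
  obtain d b where db: "F dvd Y * [:d:] - [:b, a:]"
    using frobenius_mobius_cong[OF assms(1) q(1) \<open>B \<noteq> 0\<close>, of i]
    by (auto simp: zero F_def Y_def n_def a_def)
  \<comment> \<open>Otherwise \<open>F\<close> would divide a nonzero polynomial of degree
    1.\<close>
  have "d \<noteq> 0"
  proof
    assume "d = 0"
    then have "F dvd [:b, a:]"
      using db by (simp flip: dvd_minus_iff[of F "[:b, a:]"])
    then have "[:b, a:] = 0"
      unfolding F_def using q(2) by (intro F_poly_dvd_imp_eq_0) auto
    with \<open>a \<noteq> 0\<close> show False
      by simp
  qed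
  define L where "L = [:b / d, a / d:]"
  have "F dvd [:1 / d:] * (Y * [:d:] - [:b, a:])"
    using db by (rule dvd_mult)
  also have "\<dots> = Y - L"
    using \<open>d \<noteq> 0\<close> by (simp add: L_def smult_diff_right mult.commute)
  finally have YL: "F dvd Y - L" .
  have "n = CHAR('a) ^ (m * Suc i)"
    by (simp add: n_def q power_mult power_add)
  \<comment> \<open>Since \<open>B ^ n = B\<close>, this is \<open>F_B\<close> evaluated at
    \<open>Y\<close>; hence \<open>F_B(Y)\<close>, and with it \<open>F_B(L)\<close>, vanishes
    modulo \<open>F\<close>.\<close>
  then have "F ^ n = Y ^ q * Y - [:B:] * Y + [:B:]"
    unfolding F_def Y_def using F_poly_power[OF assms(1), of n _ q B] assms(5) by (simp add: n_def)
  moreover have "n > 0"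
    using q(2) by (simp add: n_def)
  ultimately have "F dvd Y ^ q * Y - [:B:] * Y + [:B:]"
    using dvd_power[of n F] by simp
  moreover have "(Y ^ q * Y - [:B:] * Y + [:B:]) mod F = (L ^ q * L - [:B:] * L + [:B:]) mod F"
  proof -
    have cong: "Y mod F = L mod F"
      using YL by (simp only: mod_eq_dvd_iff)
    then have "Y ^ q mod F = L ^ q mod F"
      by (metis power_mod)
    with cong show ?thesis
      by (intro mod_add_cong mod_diff_cong mod_mult_cong refl)
  qed
  ultimately have "F dvd L ^ q * L - [:B:] * L + [:B:]"
    by (simp only: dvd_eq_mod_eq_0)
  then have "L = [:0, 1:]"
    using affine_endomorphism_F_poly[OF assms(1) q \<open>B \<noteq> 0\<close>, of "a / d" "b / d"] \<open>a \<noteq> 0\<close> \<open>d \<noteq> 0\<close>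
    by (simp add: L_def F_def)
  with YL show ?thesis
    by (simp add: F_def Y_def n_def)
qed

section \<open>Root counts over the finite field\<close>

text \<open>Every field element is a root of \<open>X^CARD('a) - X = p * g\<close>, and
  \<open>g\<close> accounts for at most \<open>CARD('a) - degree p\<close> of them.\<close>

lemma card_roots_of_dvd_frobenius:
  fixes p :: "'a::{field, finite} poly"
  assumes "p dvd [:0, 1:] ^ CARD('a) - [:0, 1:]"
  shows "degree p \<le> card {x. poly p x = 0}"
proof -
  have "CARD('a) > 1"
    using card_mono[of UNIV "{0, 1::'a}"] by simp
  define f where "f = [:0, 1::'a:] ^ CARD('a) - [:0, 1:]"
  have deg: "degree f = CARD('a)"
    using \<open>CARD('a) > 1\<close> unfolding f_def diff_conv_add_uminus
    by (subst degree_add_eq_left) (simp_all add: degree_power_eq)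
  obtain g where g: "f = p * g"
    using assms by (auto simp: f_def)
  have "f \<noteq> 0"
    using deg \<open>CARD('a) > 1\<close> by auto
  then have nz: "p \<noteq> 0" "g \<noteq> 0"
    by (auto simp: g)
  have "poly f x = 0" for x
    by (simp add: f_def power_CARD_eq_same)
  then have "UNIV = {x. poly p x = 0} \<union> {x. poly g x = 0}"
    by (auto simp: g)
  then have "CARD('a) \<le> card {x. poly p x = 0} + card {x. poly g x = 0}"
    by (metis card_Un_le)
  also have "card {x. poly g x = 0} \<le> degree g"
    using nz by (intro card_poly_roots_bound)
  also have "degree g = CARD('a) - degree p"
    using deg nz by (simp add: g degree_mult_eq)
  moreover have "degree p \<le> CARD('a)"
    using deg nz by (simp add: g degree_mult_eq)
  ultimately show ?thesis
    by simp
qed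

lemma frob_coeff_eq_0_of_card_roots:
  fixes B :: "'a::{field, finite}"
  assumes "q = CHAR('a) ^ m" and "q > 1" and "B \<noteq> 0" and "CARD('a) = q ^ Suc i"
    and "card {x. poly (F_poly q B) x = 0} \<ge> q + 1"
  shows "frob_coeff q B i = 0"
proof (rule ccontr)
  let ?c = "frob_coeff q B i" and ?a = "frob_coeff q B (Suc i)"
  assume nz: "?c \<noteq> 0"
  obtain d b where db:
    "F_poly q B dvd [:0, 1:] ^ (q ^ Suc i) * [:d, ?c:] - [:b, ?a:]"
    using frobenius_mobius_cong[OF finite_imp_prime_CHAR assms(1,3)] by blast
  \<comment> \<open>The fixed-point equation \<open>x (c x + d) = a x + b\<close> of the Moebius
    map. It has at most two solutions, whereas \<open>q + 1 \<ge> 3\<close>.\<close>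
  define h where "h = [:- b, d - ?a, ?c:]"
  have "poly h x = 0" if "poly (F_poly q B) x = 0" for x
  proof -
    have "poly ([:0, 1:] ^ (q ^ Suc i) * [:d, ?c:] - [:b, ?a:]) x = 0"
      using db that by (metis dvd_trans poly_eq_0_iff_dvd)
    then show ?thesis
      using power_CARD_eq_same[of x] by (simp add: assms(4) h_def algebra_simps)
  qed
  then have "{x. poly (F_poly q B) x = 0} \<subseteq> {x. poly h x = 0}"
    by blast
  moreover have "h \<noteq> 0" "degree h = 2"
    using nz by (simp_all add: h_def)
  ultimately have "card {x. poly (F_poly q B) x = 0} \<le> 2"
    using card_mono[OF poly_roots_finite[of h], of "{x. poly (F_poly q B) x = 0}"]
      card_poly_roots_bound[of h] by linarith
  with assms(2,5) show False
    by simp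
qed

theorem theorem3:
  fixes q k :: nat and B :: "'a::{field, finite}"
  assumes "primepow q" and "k \<ge> 3" and "CARD('a) = q ^ k" and "B \<noteq> 0"
  shows "(\<exists>ls :: 'a poly list. length ls = q + 1 \<and> (\<forall>l\<in>set ls. degree l = 1) \<and>
            F_poly q B = prod_list ls)
         \<longleftrightarrow> poly (P_poly q k) (1 / B) = 0"
proof -
  obtain m where m: "m > 0" "q = CHAR('a) ^ m"
    using primepow_CARD_eq_CHAR_power[OF assms(1,3)] .
  have q: "q > 1"
    using assms(1) by (rule primepow_gt_Suc_0[unfolded One_nat_def[symmetric]])
  have of_nat_q: "of_nat q = (0::'a)"
    using m by simp
  obtain i where i: "k = Suc i"
    using assms(2) by (cases k) auto
  have "frob_coeff q B i = 0 \<longleftrightarrow> card {x. poly (F_poly q B) x = 0} \<ge> q + 1"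
  proof
    assume "frob_coeff q B i = 0"
    then have "F_poly q B dvd [:0, 1:] ^ CARD('a) - [:0, 1:]"
      using F_poly_dvd_frobenius[OF finite_imp_prime_CHAR m(2) q assms(4)] power_CARD_eq_same[of B]
      by (simp add: assms(3) i)
    then show "card {x. poly (F_poly q B) x = 0} \<ge> q + 1"
      using card_roots_of_dvd_frobenius degree_F_poly[OF q] by metis
  qed (use frob_coeff_eq_0_of_card_roots m(2) q assms(3,4) i in blast)
  \<comment> \<open>The two differ by a product of powers of \<open>B\<close>, which is
    nonzero.\<close>
  moreover have "frob_coeff q B i = 0 \<longleftrightarrow> poly (P_poly q k) (1 / B) = 0"
    using assms(4) by (simp add: frob_coeff_def i)
  ultimately show ?thesis
    using F_poly_splits_iff_card_roots[OF q of_nat_q assms(4)] by blast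
qed

end
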